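(* Let $P$ be a polytope as in the context and let $\mathcal S$ be a weakly compatible set of splits of $P$. Then the tight span $\mathcal T_{w_{\mathcal S}}(P)$, where $w_{\mathcal S}=\sum_{S\in\mathcal S}w_S$, is a (not necessarily pure) zonotopal complex, i.e., each of its faces is a zonotope.
   Context: Let $P\subset\mathbb R^{d+1}$ be a $d$-dimensional polytope with vertex matrix $V$ ($n\times(d+1)$, rows the vertices) such that the all-ones vector lies in the column span of $V$. For a weight function $w\in\mathbb R^n$ the envelope is $\mathcal E_w(P)=\{x:Vx\ge -w\}$ and the tight span $\mathcal T_w(P)$ is the polytopal complex of bounded faces of $\mathcal E_w(P)$. A split of $P$ is a subdivision without new vertices with two maximal cells $S_+,S_-$; its split weight is $w_S(v)=|a\cdot v|$ for $v\in S_+$, $0$ for $v\in S_-$, where $a$ is a normal vector of the linear span $H_S$ of $S_+\cap S_-$. A set $\mathcal S$ of splits is weakly compatible if $\sum_{S\in\mathcal S}w_S$ is a coherent decomposition, i.e., $\sum_{S\in\mathcal S}\mathcal E_{w_S}(P)=\mathcal E_{w_{\mathcal S}}(P)$ (equivalently, there is a common refinement of all $S\in\mathcal S$). A zonotope is a Minkowski sum of line segments. *)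

theory Defs
  imports "HOL-Analysis.Analysis" "HOL-Library.Set_Algebras"
begin

text \<open>
  Dimension convention: \<open>'m\<close> indexes the \<open>d + 1\<close> coordinates of the ambient space and
  \<open>'n\<close> indexes the \<open>n\<close> vertices, so a vertex matrix has type \<open>real ^ 'm ^ 'n\<close>.
\<close>

definition vertex_matrix :: "real ^ 'm ^ 'n \<Rightarrow> (real ^ 'm) set \<Rightarrow> bool" where
  "vertex_matrix V P \<longleftrightarrow>
     polytope P \<and> inj (\<lambda>i. row i V) \<and> rows V = {v. v extreme_point_of P}"

text \<open>The inequality is the componentwise order on vectors.\<close>

definition envelope :: "real ^ 'm ^ 'n \<Rightarrow> real ^ 'n \<Rightarrow> (real ^ 'm) set" where
  "envelope V w = {x. V *v x \<ge> - w}"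

definition tight_span :: "real ^ 'm ^ 'n \<Rightarrow> real ^ 'n \<Rightarrow> (real ^ 'm) set set" where
  "tight_span V w = {F. F face_of envelope V w \<and> bounded F}"

text \<open>
  As with \<^const>\<open>face_of\<close>, the empty set counts as a face, hence as a cell of every
  non-empty complex.
\<close>

definition polytopal_complex :: "'a::euclidean_space set set \<Rightarrow> bool" where
  "polytopal_complex K \<longleftrightarrow>
     finite K \<and>
     (\<forall>C\<in>K. polytope C) \<and>
     (\<forall>C\<in>K. \<forall>F. F face_of C \<longrightarrow> F \<in> K) \<and>
     (\<forall>C\<in>K. \<forall>D\<in>K. (C \<inter> D) face_of C \<and> (C \<inter> D) face_of D)"

definition subdivision_without_new_vertices ::
    "'a::euclidean_space set set \<Rightarrow> 'a set \<Rightarrow> bool" where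
  "subdivision_without_new_vertices K P \<longleftrightarrow>
     polytopal_complex K \<and> \<Union>K = P \<and>
     (\<forall>C\<in>K. \<forall>v. v extreme_point_of C \<longrightarrow> v extreme_point_of P)"

definition maximal_cells :: "'a set set \<Rightarrow> 'a set set" where
  "maximal_cells K = {C\<in>K. \<forall>D\<in>K. C \<subseteq> D \<longrightarrow> C = D}"

definition is_split :: "'a::euclidean_space set set \<Rightarrow> 'a set \<Rightarrow> bool" where
  "is_split S P \<longleftrightarrow>
     subdivision_without_new_vertices S P \<and> card (maximal_cells S) = 2"

text \<open>
  The sides \<open>Sp\<close>, \<open>Sm\<close> and the normal vector \<open>a\<close> are not determined by the split:
  the sides can be exchanged and \<open>a\<close> can be rescaled. They are therefore explicit data.
\<close>

definition split_data ::
    "'a::euclidean_space set set \<Rightarrow> 'a set \<Rightarrow> 'a set \<Rightarrow> 'a \<Rightarrow> bool" where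
  "split_data S Sp Sm a \<longleftrightarrow>
     maximal_cells S = {Sp, Sm} \<and> a \<noteq> 0 \<and> (\<forall>x\<in>span (Sp \<inter> Sm). orthogonal a x)"

text \<open>Vertices in both cells lie in the hyperplane orthogonal to \<open>a\<close>, so they get weight 0.\<close>

definition split_weight ::
    "real ^ 'm ^ 'n \<Rightarrow> (real ^ 'm) set \<Rightarrow> real ^ 'm \<Rightarrow> real ^ 'n" where
  "split_weight V Sp a = (\<chi> i. if row i V \<in> Sp then \<bar>a \<bullet> row i V\<bar> else 0)"

text \<open>The sum of envelopes is the Minkowski sum of \<^theory>\<open>HOL-Library.Set_Algebras\<close>.\<close>

definition coherent_decomposition ::
    "real ^ 'm ^ 'n \<Rightarrow> 's set \<Rightarrow> ('s \<Rightarrow> real ^ 'n) \<Rightarrow> bool" where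
  "coherent_decomposition V I w \<longleftrightarrow>
     (\<Sum>S\<in>I. envelope V (w S)) = envelope V (\<Sum>S\<in>I. w S)"

text \<open>
  The empty Minkowski sum is \<open>{0}\<close> whereas the envelope of the zero weight is an unbounded
  cone. The empty set of splits, whose common refinement is the trivial subdivision, is
  therefore admitted separately.
\<close>

definition weakly_compatible ::
    "real ^ 'm ^ 'n \<Rightarrow> 's set \<Rightarrow> ('s \<Rightarrow> (real ^ 'm) set) \<Rightarrow> ('s \<Rightarrow> real ^ 'm) \<Rightarrow> bool" where
  "weakly_compatible V \<S> Sp a \<longleftrightarrow>
     \<S> = {} \<or> coherent_decomposition V \<S> (\<lambda>S. split_weight V (Sp S) (a S))"

text \<open>Segments may be degenerate, so points are zonotopes.\<close>

definition zonotope :: "'a::euclidean_space set \<Rightarrow> bool" where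
  "zonotope Z \<longleftrightarrow>
     (\<exists>(k::nat) p q. Z = (\<Sum>i<k. closed_segment (p i) (q i)))"

definition zonotopal_complex :: "'a::euclidean_space set set \<Rightarrow> bool" where
  "zonotopal_complex K \<longleftrightarrow> polytopal_complex K \<and> (\<forall>F\<in>K. F \<noteq> {} \<longrightarrow> zonotope F)"

end

theory Submission
  imports Defs
begin

text \<open>
  Let \<open>C = {x. V x \<ge> 0}\<close>. A split with normal \<open>b\<close>, oriented to be nonnegative on \<open>S\<^sub>+\<close>, has
  weight \<open>max 0 (b \<bullet> v)\<close>, and since it introduces no new vertices its envelope is \<open>[0, -b] + C\<close>:
  the inequalities that \<open>t\<close> must satisfy for \<open>x + t b \<in> C\<close> are consistent because a segment from a
  vertex of \<open>S\<^sub>+\<close> to a vertex of \<open>S\<^sub>-\<close> crosses the hyperplane in a point of the convex hull of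
  the vertices of \<open>P\<close> on that hyperplane. By coherence the envelope of the sum of the weights is
  \<open>Z + C\<close> with a zonotope \<open>Z\<close>. A bounded face of \<open>Z + C\<close> is a face of \<open>Z\<close>, and faces of
  zonotopes are zonotopes.
\<close>

section \<open>Zonotopes\<close>

lemma zonotope_closed_segment: "zonotope (closed_segment p q)"
  unfolding zonotope_def
  by (intro exI[of _ "1::nat"] exI[of _ "\<lambda>_. p"] exI[of _ "\<lambda>_. q"]) simp

lemma zonotope_0: "zonotope {0}"
  unfolding zonotope_def by (intro exI[of _ "0::nat"]) simp

lemma zonotope_set_plus:
  assumes "zonotope A" "zonotope B"
  shows "zonotope (A + B)"
proof -
  obtain k p q where A: "A = (\<Sum>i<(k::nat). closed_segment (p i) (q i))"
    using assms(1) by (auto simp: zonotope_def)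
  obtain l r s where B: "B = (\<Sum>i<(l::nat). closed_segment (r i) (s i))"
    using assms(2) by (auto simp: zonotope_def)
  let ?f = "\<lambda>i. closed_segment (if i < k then p i else r (i - k)) (if i < k then q i else s (i - k))"
  have "sum ?f {..<k + l} = sum ?f {..<k} + (\<Sum>i<l. ?f (k + i))"
    by (induction l) (simp_all add: add.assoc)
  also have "\<dots> = A + B"
    unfolding A B by simp
  finally show ?thesis
    unfolding zonotope_def by metis
qed

lemma zonotope_sum:
  assumes "\<And>i. i \<in> I \<Longrightarrow> zonotope (f i)"
  shows "zonotope (sum f I)"
  using assms
  by (induction I rule: infinite_finite_induct) (auto intro: zonotope_0 zonotope_set_plus)

section \<open>Faces of Minkowski sums and of zonotopes\<close>

text \<open>The summands are the points of \<open>A\<close> and of \<open>B\<close> that occur in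
  some decomposition of a point of \<open>F\<close>. That every mixed sum of such points stays in
  \<open>F\<close> is a parallelogram argument.\<close>

lemma face_of_set_plus:
  fixes A B :: "'a::real_vector set"
  assumes F: "F face_of A + B" and "convex A" "convex B"
  obtains A' B' where "A' face_of A" "B' face_of B" "F = A' + B'"
proof -
  have sub: "F \<subseteq> A + B" and cF: "convex F"
    and op: "\<And>x y z. \<lbrakk>x \<in> A + B; y \<in> A + B; z \<in> F; z \<in> open_segment x y\<rbrakk> \<Longrightarrow> x \<in> F \<and> y \<in> F"
    using F unfolding face_of_def by blast+
  \<comment> \<open>Kept symmetric in the summands to serve both \<open>A\<close> and
    \<open>B\<close>. Translation by a partner \<open>y\<close> carries segments of \<open>X\<close>
    into \<open>A + B\<close>, where \<open>F\<close> is extreme.\<close>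
  have face: "{x \<in> X. \<exists>y\<in>Y. x + y \<in> F} face_of X"
    if "convex X" "convex Y" "X + Y = A + B" for X Y
    unfolding face_of_def
  proof (intro conjI ballI impI)
    show "convex {x \<in> X. \<exists>y\<in>Y. x + y \<in> F}"
    proof (rule convexI)
      fix x1 x2 and u v :: real
      assume x1: "x1 \<in> {x \<in> X. \<exists>y\<in>Y. x + y \<in> F}" and x2: "x2 \<in> {x \<in> X. \<exists>y\<in>Y. x + y \<in> F}"
        and uv: "0 \<le> u" "0 \<le> v" "u + v = 1"
      obtain y1 y2 where y: "y1 \<in> Y" "y2 \<in> Y" "x1 + y1 \<in> F" "x2 + y2 \<in> F"
        using x1 x2 by blast
      have "u *\<^sub>R (x1 + y1) + v *\<^sub>R (x2 + y2) \<in> F"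
        using convexD[OF cF y(3,4) uv] .
      then have "(u *\<^sub>R x1 + v *\<^sub>R x2) + (u *\<^sub>R y1 + v *\<^sub>R y2) \<in> F"
        by (simp add: algebra_simps)
      then show "u *\<^sub>R x1 + v *\<^sub>R x2 \<in> {x \<in> X. \<exists>y\<in>Y. x + y \<in> F}"
        using convexD[OF that(1) _ _ uv, of x1 x2] convexD[OF that(2) y(1,2) uv] x1 x2 by blast
    qed
  next
    fix x1 x2 x
    assume x: "x1 \<in> X" "x2 \<in> X" "x \<in> {x \<in> X. \<exists>y\<in>Y. x + y \<in> F}" "x \<in> open_segment x1 x2"
    then obtain y where y: "y \<in> Y" "x + y \<in> F"
      by blast
    have "x + y \<in> open_segment (x1 + y) (x2 + y)"
      using x(4) by (simp add: open_segment_translation_eq add.commute[of _ y])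
    moreover have "x1 + y \<in> A + B" "x2 + y \<in> A + B"
      using x y that(3) by blast+
    ultimately have "x1 + y \<in> F \<and> x2 + y \<in> F"
      using op y(2) by blast
    then show "x1 \<in> {x \<in> X. \<exists>y\<in>Y. x + y \<in> F}" "x2 \<in> {x \<in> X. \<exists>y\<in>Y. x + y \<in> F}"
      using x y by blast+
  qed blast
  define A' where "A' = {x \<in> A. \<exists>y\<in>B. x + y \<in> F}"
  define B' where "B' = {y \<in> B. \<exists>x\<in>A. y + x \<in> F}"
  have "A' + B' \<subseteq> F"
  proof
    fix z assume "z \<in> A' + B'"
    then obtain x y where xy: "x \<in> A'" "y \<in> B'" "z = x + y"
      by (elim set_plus_elim)
    obtain y1 where y1: "y1 \<in> B" "x + y1 \<in> F"
      using xy by (auto simp: A'_def)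
    obtain x1 where x1: "x1 \<in> A" "x1 + y \<in> F"
      using xy by (auto simp: B'_def add.commute)
    have mem: "x + y \<in> A + B" "x1 + y1 \<in> A + B"
      using xy x1 y1 by (auto simp: A'_def B'_def)
    \<comment> \<open>The diagonals of the parallelogram share their midpoint. One diagonal has its
      ends in \<open>F\<close>, so the midpoint is in \<open>F\<close>, and extremality pulls in the
      ends of the other.\<close>
    have mid: "midpoint (x + y) (x1 + y1) = midpoint (x + y1) (x1 + y)"
      by (simp add: midpoint_def algebra_simps)
    have "midpoint (x + y1) (x1 + y) \<in> F"
      using cF x1 y1 by (metis convex_contains_segment midpoint_in_closed_segment subsetD)
    then have inF: "midpoint (x + y) (x1 + y1) \<in> F"
      by (simp add: mid)
    show "z \<in> F"
    proof (cases "x + y = x1 + y1")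
      case True
      then show ?thesis using inF xy by simp
    next
      case False
      then show ?thesis
        using op[OF mem inF] xy by (simp add: midpoint_in_open_segment)
    qed
  qed
  moreover have "F \<subseteq> A' + B'"
  proof
    fix z assume z: "z \<in> F"
    then obtain x y where xy: "x \<in> A" "y \<in> B" "z = x + y"
      using sub by (blast elim: set_plus_elim)
    then have "x \<in> A'" "y \<in> B'"
      using z by (auto simp: A'_def B'_def add.commute)
    then show "z \<in> A' + B'"
      using xy by blast
  qed
  moreover have "A' face_of A" "B' face_of B"
    unfolding A'_def B'_def using face assms(2,3) by (auto simp: add.commute)
  ultimately show ?thesis
    using that by blast
qed

text \<open>Induction on the number of segments: a face of the sum splits into a face of the shorter
  sum and a non-empty face of a segment, which is an endpoint or the whole segment.\<close>

lemma zonotope_face: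
  assumes "zonotope Z" "F face_of Z" "F \<noteq> {}"
  shows "zonotope F"
proof -
  obtain k p q where Z: "Z = (\<Sum>i<(k::nat). closed_segment (p i) (q i))"
    using assms(1) by (auto simp: zonotope_def)
  show ?thesis
    using assms(2,3) unfolding Z
  proof (induction k arbitrary: F)
    case 0
    then have "F = 0"
      by (auto simp: set_zero dest: face_of_imp_subset)
    then show ?case
      by (simp add: zonotope_0)
  next
    case (Suc k)
    let ?Z = "\<Sum>i<k. closed_segment (p i) (q i)"
    have "convex ?Z"
      by (intro convex_set_sum convex_closed_segment)
    moreover have "F face_of ?Z + closed_segment (p k) (q k)"
      using Suc.prems(1) by (simp only: sum.lessThan_Suc)
    ultimately obtain A B
      where AB: "A face_of ?Z" "B face_of closed_segment (p k) (q k)" "F = A + B"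
      using face_of_set_plus convex_closed_segment by blast
    then have ne: "A \<noteq> {}" "B \<noteq> {}"
      using Suc.prems by (auto simp: set_plus_def)
    obtain T where T: "T \<subseteq> {p k, q k}" "B = convex hull T"
      using face_of_convex_hull_subset[of "{p k, q k}" B] AB(2)
      by (auto simp: segment_convex_hull)
    have "T \<noteq> {}"
      using ne(2) T(2) by auto
    then consider "T = {p k}" | "T = {q k}" | "T = {p k, q k}"
      using T(1) by blast
    then have "B = closed_segment (p k) (p k) \<or> B = closed_segment (q k) (q k) \<or>
        B = closed_segment (p k) (q k)"
      by cases (use T in \<open>auto simp: segment_convex_hull\<close>)
    then have "zonotope B"
      using zonotope_closed_segment by blast
    then show ?case
      using Suc.IH[OF AB(1) ne(1)] AB(3) by (simp add: zonotope_set_plus)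
  qed
qed

section \<open>Envelopes\<close>

lemma mem_envelope: "x \<in> envelope V w \<longleftrightarrow> (\<forall>i. - (w $ i) \<le> row i V \<bullet> x)"
  by (simp add: envelope_def less_eq_vec_def matrix_vector_mul_component row_def vec_lambda_eta)

lemma polyhedron_envelope: "polyhedron (envelope V w)"
proof -
  have "envelope V w = (\<Inter>i. {x. row i V \<bullet> x \<ge> - (w $ i)})"
    by (auto simp: mem_envelope)
  then show ?thesis
    by (auto intro!: polyhedron_Inter polyhedron_halfspace_ge)
qed

lemma polytopal_complex_tight_span: "polytopal_complex (tight_span V w)"
proof -
  have "finite (tight_span V w)"
    by (rule finite_subset[OF _ finite_polyhedron_faces[OF polyhedron_envelope[of V w]]])
      (auto simp: tight_span_def)
  moreover have "(C \<inter> D) face_of C" if "C \<in> tight_span V w" "D \<in> tight_span V w" for C D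
    using that by (auto simp: tight_span_def intro: face_of_subset face_of_Int dest: face_of_imp_subset)
  moreover have "polytope C" if "C \<in> tight_span V w" for C
    using that polyhedron_envelope[of V w]
    by (auto simp: tight_span_def polytope_eq_bounded_polyhedron
        intro: face_of_polyhedron_polyhedron)
  moreover have "F \<in> tight_span V w" if "C \<in> tight_span V w" "F face_of C" for C F
    using that by (auto simp: tight_span_def intro: face_of_trans bounded_subset
        dest: face_of_imp_subset)
  ultimately show ?thesis
    unfolding polytopal_complex_def by (metis inf_commute)
qed

section \<open>The cone \<open>envelope V 0\<close> as a Minkowski summand\<close>

lemma envelope_0_add: "envelope V 0 + envelope V 0 = envelope V 0"
proof
  show "envelope V 0 + envelope V 0 \<subseteq> envelope V 0"
    by (auto simp: set_plus_def mem_envelope inner_add_right)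
  have "0 \<in> envelope V 0"
    by (simp add: mem_envelope)
  then show "envelope V 0 \<subseteq> envelope V 0 + envelope V 0"
    by (metis add_0 set_plus_intro subsetI)
qed

text \<open>The copies of the cone contributed by the single splits merge into one. An empty or
  infinite sum would be \<open>{0}\<close> and contribute no cone.\<close>

lemma sum_add_envelope_0:
  assumes "finite I" "I \<noteq> {}"
  shows "(\<Sum>i\<in>I. f i + envelope V 0) = sum f I + envelope V 0"
  using assms
proof (induction I rule: finite_ne_induct)
  case (insert i I)
  then have "(\<Sum>i\<in>insert i I. f i + envelope V 0) =
      (f i + sum f I) + (envelope V 0 + envelope V 0)"
    by (simp add: ac_simps)
  then show ?case
    using insert by (simp add: envelope_0_add)
qed simp

text \<open>If a point \<open>z + c\<close> of the face had \<open>c \<noteq> 0\<close>, it would be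
  interior to arbitrarily long segments from \<open>z\<close> in direction \<open>c\<close>, all
  inside the sum, and the face would be unbounded.\<close>

lemma bounded_face_of_add_envelope_0:
  assumes F: "F face_of Z + envelope V 0" and "bounded F"
  shows "F face_of Z"
proof (rule face_of_subset[OF F])
  have 0: "0 \<in> envelope V 0"
    by (simp add: mem_envelope)
  show "Z \<subseteq> Z + envelope V 0"
    using 0 by (metis add.right_neutral set_plus_intro subsetI)
  show "F \<subseteq> Z"
  proof
    fix x assume x: "x \<in> F"
    then obtain z c where zc: "z \<in> Z" "c \<in> envelope V 0" "x = z + c"
      using face_of_imp_subset[OF F] by (blast elim: set_plus_elim)
    have "c = 0"
    proof (rule ccontr)
      assume c: "c \<noteq> 0"
      obtain B where B: "\<And>y. y \<in> F \<Longrightarrow> norm y \<le> B"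
        using \<open>bounded F\<close> by (auto simp: bounded_iff)
      \<comment> \<open>The 2 makes \<open>t > 1\<close>, so that \<open>x\<close> lies strictly
        before \<open>z + t *\<^sub>R c\<close>; the quotient pushes that point beyond the bound
        \<open>B\<close>.\<close>
      define t where "t = 2 + (\<bar>B\<bar> + norm z) / norm c"
      have t: "t > 1"
      proof -
        have "0 \<le> (\<bar>B\<bar> + norm z) / norm c"
          by simp
        then show ?thesis
          unfolding t_def by linarith
      qed
      have "t *\<^sub>R c \<in> envelope V 0"
        using zc(2) t by (auto simp: mem_envelope)
      then have mem: "z + t *\<^sub>R c \<in> Z + envelope V 0" "z \<in> Z + envelope V 0"
        using set_plus_intro[OF zc(1)] set_plus_intro[OF zc(1) 0] by simp_all
      have "x = (1 - 1 / t) *\<^sub>R z + (1 / t) *\<^sub>R (z + t *\<^sub>R c)"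
        using t zc(3) by (simp add: algebra_simps)
      then have "x \<in> open_segment z (z + t *\<^sub>R c)"
        using t c by (auto simp: in_segment intro!: exI[of _ "1 / t"])
      then have "z + t *\<^sub>R c \<in> F"
        using face_ofD[OF F _ mem(2,1) x] by blast
      then have "norm (z + t *\<^sub>R c) \<le> B"
        by (rule B)
      moreover have "t * norm c \<le> norm (z + t *\<^sub>R c) + norm z"
        using norm_triangle_ineq4[of "z + t *\<^sub>R c" z] t by simp
      moreover have "t * norm c = 2 * norm c + \<bar>B\<bar> + norm z"
        using c by (simp add: t_def field_simps)
      ultimately show False
        using c by (smt (verit) zero_less_norm_iff)
    qed
    then show "x \<in> Z"
      using zc by simp
  qed
qed

text \<open>Given \<open>x\<close>, some \<open>t\<close> in [0, 1] must bring
  \<open>x + t *\<^sub>R b\<close> into the cone. Rows with \<open>b \<bullet> row i V > 0\<close>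
  bound \<open>t\<close> from below, rows with negative value from above; \<open>cross\<close> says,
  with denominators cleared, that each lower bound is at most each upper bound.\<close>

lemma envelope_max_0:
  fixes V :: "real ^ 'm ^ 'n"
  assumes w: "\<And>i. w $ i = max 0 (b \<bullet> row i V)"
    and cross: "\<And>x i j. \<lbrakk>x \<in> envelope V w; 0 < b \<bullet> row i V; b \<bullet> row j V < 0\<rbrakk> \<Longrightarrow>
      0 \<le> (row j V \<bullet> x) * (b \<bullet> row i V) - (row i V \<bullet> x) * (b \<bullet> row j V)"
  shows "envelope V w = closed_segment 0 (- b) + envelope V 0"
proof (intro equalityI subsetI)
  fix x assume x: "x \<in> envelope V w"
  then have x': "- max 0 (b \<bullet> row i V) \<le> row i V \<bullet> x" for i
    by (simp add: mem_envelope w)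
  \<comment> \<open>\<open>L\<close> holds all lower bounds on \<open>t\<close>, including 0; its
    maximum is the least candidate.\<close>
  define L where "L = insert 0 ((\<lambda>i. - (row i V \<bullet> x) / (b \<bullet> row i V)) ` {i. 0 < b \<bullet> row i V})"
  define t where "t = Max L"
  have "finite L" "L \<noteq> {}"
    by (auto simp: L_def)
  then have tL: "t \<in> L" and tge: "\<And>s. s \<in> L \<Longrightarrow> s \<le> t"
    by (auto simp: t_def)
  have t0: "0 \<le> t"
    using tge by (simp add: L_def)
  \<comment> \<open>A row with positive \<open>b \<bullet> row i V\<close> has exactly that weight,
    so its lower bound is at most 1.\<close>
  have t1: "t \<le> 1"
  proof -
    have "- (row i V \<bullet> x) / (b \<bullet> row i V) \<le> 1" if "0 < b \<bullet> row i V" for i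
      using that x'[of i] by (simp add: field_simps)
    then show ?thesis
      using tL unfolding L_def by auto
  qed
  have "0 \<le> row j V \<bullet> (x + t *\<^sub>R b)" for j
  proof -
    consider "0 < b \<bullet> row j V" | "b \<bullet> row j V = 0" | "b \<bullet> row j V < 0"
      by linarith
    then show ?thesis
    proof cases
      case 1
      then have "- (row j V \<bullet> x) / (b \<bullet> row j V) \<le> t"
        by (intro tge) (auto simp: L_def)
      with 1 show ?thesis
        by (simp add: inner_add_right inner_commute field_simps)
    next
      case 2
      with x'[of j] show ?thesis
        by (simp add: inner_add_right inner_commute)
    next
      case 3
      \<comment> \<open>For an upper-bound row it matters which lower bound \<open>t\<close>
        attains: at 0 the row has weight 0, so \<open>x\<close> itself satisfies the inequality;
        otherwise \<open>cross\<close> compares the two rows.\<close>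
      consider "t = 0" | i where "0 < b \<bullet> row i V" "t = - (row i V \<bullet> x) / (b \<bullet> row i V)"
        using tL by (auto simp: L_def)
      then show ?thesis
      proof cases
        case 1
        with 3 x'[of j] show ?thesis by simp
      next
        case (2 i)
        then have "row i V \<bullet> x = - t * (b \<bullet> row i V)"
          by simp
        then have "(row j V \<bullet> x) * (b \<bullet> row i V) - (row i V \<bullet> x) * (b \<bullet> row j V) =
            (b \<bullet> row i V) * (row j V \<bullet> (x + t *\<^sub>R b))"
          by (simp add: inner_add_right inner_commute[of b "row j V"] algebra_simps)
        with cross[OF x 2(1) 3] 2(1) show ?thesis
          by (simp add: zero_le_mult_iff)
      qed
    qed
  qed
  then have "x + t *\<^sub>R b \<in> envelope V 0"
    by (simp add: mem_envelope)
  moreover have "- (t *\<^sub>R b) \<in> closed_segment 0 (- b)"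
    using t0 t1 by (auto simp: in_segment)
  moreover have "x = - (t *\<^sub>R b) + (x + t *\<^sub>R b)"
    by simp
  ultimately show "x \<in> closed_segment 0 (- b) + envelope V 0"
    by (metis set_plus_intro)
next
  fix x assume "x \<in> closed_segment 0 (- b) + envelope V 0"
  then obtain y t where yt: "x = - (t *\<^sub>R b) + y" "0 \<le> t" "t \<le> 1" "y \<in> envelope V 0"
    by (auto simp: in_segment elim!: set_plus_elim)
  show "x \<in> envelope V w"
    unfolding mem_envelope
  proof
    fix i
    have "t * (b \<bullet> row i V) \<le> max 0 (b \<bullet> row i V)"
      using yt mult_left_le_one_le[of "b \<bullet> row i V" t] mult_nonneg_nonpos[of t "b \<bullet> row i V"]
      by (smt (verit))
    moreover have "0 \<le> row i V \<bullet> y"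
      using yt by (simp add: mem_envelope)
    ultimately show "- (w $ i) \<le> row i V \<bullet> x"
      by (simp add: yt w inner_diff_right inner_commute[of _ b])
  qed
qed

section \<open>Splits\<close>

text \<open>A segment is connected, so two closed sets that cover it and both meet it cannot be
  disjoint on it.\<close>

lemma segment_meets_Int:
  fixes A B :: "'a::real_normed_vector set"
  assumes "closed A" "closed B" "convex (A \<union> B)" "x \<in> A" "z \<in> B"
  shows "\<exists>t\<in>{0..1}. (1 - t) *\<^sub>R x + t *\<^sub>R z \<in> A \<inter> B"
proof -
  have "closed_segment x z \<subseteq> A \<union> B"
    using assms by (simp add: closed_segment_subset)
  then have "A \<inter> B \<inter> closed_segment x z \<noteq> {}"
    using connected_closedD[OF connected_segment(1), of A B x z] assms by auto
  then show ?thesis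
    by (auto simp: in_segment)
qed

text \<open>Along the segment from \<open>x\<close> to \<open>z\<close> the functional is affine,
  positive at \<open>x\<close>, and zero at a point of \<open>A \<inter> B\<close>. If it vanishes
  at \<open>z\<close>, that point is \<open>z\<close> itself, which then lies in
  \<open>A\<close>.\<close>

lemma opposite_sign_across_Int:
  fixes A B :: "'a::real_inner set"
  assumes "closed A" "closed B" "convex (A \<union> B)"
    and orth: "\<And>y. y \<in> A \<inter> B \<Longrightarrow> a \<bullet> y = 0"
    and "x \<in> A" "0 < a \<bullet> x" "z \<in> B"
  shows "a \<bullet> z \<le> 0" and "z \<notin> A \<Longrightarrow> a \<bullet> z < 0"
proof -
  obtain t where t: "0 \<le> t" "t \<le> 1" "(1 - t) *\<^sub>R x + t *\<^sub>R z \<in> A \<inter> B"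
    using segment_meets_Int[of A B x z] assms by auto
  have eq: "(1 - t) * (a \<bullet> x) + t * (a \<bullet> z) = 0"
    using orth[OF t(3)] by (simp add: inner_add_right)
  show le: "a \<bullet> z \<le> 0"
    using eq t \<open>0 < a \<bullet> x\<close>
    by (smt (verit, best) mult_nonneg_nonneg mult_pos_pos mult_cancel_right1)
  show "a \<bullet> z < 0" if "z \<notin> A"
  proof (rule ccontr)
    assume "\<not> a \<bullet> z < 0"
    then have "a \<bullet> z = 0"
      using le by simp
    then have "t = 1"
      using eq \<open>0 < a \<bullet> x\<close> by simp
    then show False
      using t that by simp
  qed
qed

text \<open>Orients the normal so that \<open>A\<close> is on its nonnegative side.\<close>

lemma Int_separates:
  fixes A B :: "'a::real_inner set"
  assumes AB: "closed A" "closed B" "convex (A \<union> B)" "\<not> A \<subseteq> B" "\<not> B \<subseteq> A"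
    and orth: "\<And>y. y \<in> A \<inter> B \<Longrightarrow> a \<bullet> y = 0"
    and ne: "x \<in> A \<union> B" "a \<bullet> x \<noteq> 0"
  obtains b where "b = a \<or> b = - a" "\<And>y. y \<in> A \<Longrightarrow> 0 \<le> b \<bullet> y" "\<And>y. y \<in> B \<Longrightarrow> b \<bullet> y \<le> 0"
proof -
  obtain z where z: "z \<in> B" "z \<notin> A"
    using AB by blast
  obtain z' where z': "z' \<in> A" "z' \<notin> B"
    using AB by blast
  \<comment> \<open>One positive value on \<open>A\<close> fixes the sign on all of \<open>B\<close>
    and is strict at \<open>z\<close>; from \<open>z\<close> the same argument with
    \<open>- b\<close> and the sets exchanged fixes the sign on \<open>A\<close>.\<close>
  have key: "(\<forall>y\<in>A. 0 \<le> b \<bullet> y) \<and> (\<forall>y\<in>B. b \<bullet> y \<le> 0)"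
    if b: "\<And>y. y \<in> A \<inter> B \<Longrightarrow> b \<bullet> y = 0" and x: "x \<in> A" "0 < b \<bullet> x" for b x
  proof -
    have "b \<bullet> z < 0"
      using opposite_sign_across_Int(2)[of A B b x z] AB b x z by blast
    then have "- b \<bullet> y \<le> 0" if "y \<in> A" for y
      using opposite_sign_across_Int(1)[of B A "- b" z y] AB b z that by (auto simp: Un_commute)
    moreover have "b \<bullet> y \<le> 0" if "y \<in> B" for y
      using opposite_sign_across_Int(1)[of A B b x y] AB b x that by blast
    ultimately show ?thesis by auto
  qed
  \<comment> \<open>If the given point is only in \<open>B\<close>, the strict sign at
    \<open>z'\<close> provides one in \<open>A\<close>.\<close>
  have "\<exists>x\<in>A. a \<bullet> x \<noteq> 0"
  proof (cases "x \<in> A")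
    case False
    then have x: "x \<in> B" using ne by simp
    show ?thesis
    proof (cases "0 < a \<bullet> x")
      case True
      then have "a \<bullet> z' < 0"
        using opposite_sign_across_Int(2)[of B A a x z'] AB orth x z' by (auto simp: Un_commute)
      then show ?thesis using z' by force
    next
      case False
      then have "- a \<bullet> z' < 0"
        using opposite_sign_across_Int(2)[of B A "- a" x z'] AB orth x z' ne
        by (auto simp: Un_commute)
      then show ?thesis using z' by force
    qed
  qed (use ne in blast)
  then obtain x' where "x' \<in> A" "0 < a \<bullet> x' \<or> 0 < - a \<bullet> x'"
    by force
  then show ?thesis
    using key[of a x'] key[of "- a" x'] orth that[of a] that[of "- a"] by auto
qed

section \<open>Envelope of a split weight\<close>

lemma Union_maximal_cells:
  assumes "finite K"
  shows "\<Union>(maximal_cells K) = \<Union>K"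
proof
  show "\<Union>K \<subseteq> \<Union>(maximal_cells K)"
  proof
    fix x assume "x \<in> \<Union>K"
    then obtain C where C: "C \<in> K" "x \<in> C" by blast
    obtain D where "D \<in> K" "C \<subseteq> D" "\<forall>E\<in>K. D \<subseteq> E \<longrightarrow> D = E"
      using finite_has_maximal2[OF assms C(1)] by blast
    then show "x \<in> \<Union>(maximal_cells K)"
      using C by (auto simp: maximal_cells_def)
  qed
qed (auto simp: maximal_cells_def)

lemma envelope_split_weight:
  fixes V :: "real ^ 'm ^ 'n"
  assumes V: "vertex_matrix V P"
    and full: "\<exists>v\<in>P. a \<bullet> v \<noteq> 0"
    and S: "is_split S P" "split_data S Sp Sm a"
  shows "\<exists>p. envelope V (split_weight V Sp a) = closed_segment 0 p + envelope V 0"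
proof -
  have rows: "rows V = {v. v extreme_point_of P}" and "polytope P"
    using V by (auto simp: vertex_matrix_def)
  have K: "polytopal_complex S" "\<Union>S = P"
    and vert: "\<And>C v. \<lbrakk>C \<in> S; v extreme_point_of C\<rbrakk> \<Longrightarrow> v extreme_point_of P"
    and card: "card (maximal_cells S) = 2"
    using S(1) by (auto simp: is_split_def subdivision_without_new_vertices_def)
  have mc: "maximal_cells S = {Sp, Sm}"
    and orth: "\<And>x. x \<in> Sp \<inter> Sm \<Longrightarrow> a \<bullet> x = 0"
    using S(2) by (auto simp: split_data_def orthogonal_def span_base)
  have cells: "Sp \<in> S" "Sm \<in> S" "\<not> Sp \<subseteq> Sm" "\<not> Sm \<subseteq> Sp"
  proof -
    have "Sp \<noteq> Sm"
      using card mc by auto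
    moreover have "Sp \<in> maximal_cells S" "Sm \<in> maximal_cells S"
      using mc by auto
    ultimately show "Sp \<in> S" "Sm \<in> S" "\<not> Sp \<subseteq> Sm" "\<not> Sm \<subseteq> Sp"
      unfolding maximal_cells_def by blast+
  qed
  have P: "P = Sp \<union> Sm"
    using Union_maximal_cells[of S] K mc by (auto simp: polytopal_complex_def)
  have poly: "polytope Sp" "polytope Sm"
    using K cells by (auto simp: polytopal_complex_def)
  then have closed: "closed Sp" "closed Sm"
    by (auto intro: compact_imp_closed polytope_imp_compact)
  have conv: "convex (Sp \<union> Sm)"
    using \<open>polytope P\<close> P by (simp add: polytope_imp_convex)
  obtain b where b: "b = a \<or> b = - a"
    and pos: "\<And>y. y \<in> Sp \<Longrightarrow> 0 \<le> b \<bullet> y" and neg: "\<And>y. y \<in> Sm \<Longrightarrow> b \<bullet> y \<le> 0"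
    using Int_separates[OF closed conv cells(3,4) orth] full P by metis
  have row_P: "row i V extreme_point_of P" for i
    using rows by (auto simp: rows_def)
  then have row_mem: "row i V \<in> Sp \<union> Sm" for i
    using P by (auto simp: extreme_point_of_def)
  \<comment> \<open>On \<open>Sp\<close> the absolute value is the value of \<open>b\<close>; a row
    outside \<open>Sp\<close> lies in \<open>Sm\<close>, where \<open>b\<close> is
    nonpositive.\<close>
  have w: "split_weight V Sp a $ i = max 0 (b \<bullet> row i V)" for i
  proof (cases "row i V \<in> Sp")
    case True
    then show ?thesis
      using b pos[OF True] by (auto simp: split_weight_def)
  next
    case False
    then show ?thesis
      using row_mem[of i] neg[of "row i V"] by (auto simp: split_weight_def)
  qed
  \<comment> \<open>As a face of a cell the intersection is a cell, so its vertices are vertices of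
    \<open>P\<close>, that is, rows of \<open>V\<close>.\<close>
  have F: "Sp \<inter> Sm \<in> S"
    using K cells unfolding polytopal_complex_def by blast
  have cross: "0 \<le> (row j V \<bullet> x) * (b \<bullet> row i V) - (row i V \<bullet> x) * (b \<bullet> row j V)"
    if x: "x \<in> envelope V (split_weight V Sp a)" and i: "0 < b \<bullet> row i V"
      and j: "b \<bullet> row j V < 0" for x i j
  proof -
    have "row i V \<in> Sp" "row j V \<in> Sm"
      using row_mem[of i] row_mem[of j] i j pos neg by force+
    then obtain t where t: "(1 - t) *\<^sub>R row i V + t *\<^sub>R row j V \<in> Sp \<inter> Sm"
      using segment_meets_Int[OF closed conv] by blast
    have "(1 - t) * (b \<bullet> row i V) + t * (b \<bullet> row j V) = 0"
      using orth[OF t] b by (auto simp: inner_add_right)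
    then have teq: "t * (b \<bullet> row i V - b \<bullet> row j V) = b \<bullet> row i V"
      by (simp add: algebra_simps)
    \<comment> \<open>Rows on the hyperplane have weight 0, so \<open>x\<close> is nonnegative on
      them, and hence on their convex hull \<open>Sp \<inter> Sm\<close>.\<close>
    have ext: "{v. v extreme_point_of (Sp \<inter> Sm)} \<subseteq> {y. 0 \<le> x \<bullet> y}"
    proof
      fix v assume "v \<in> {v. v extreme_point_of (Sp \<inter> Sm)}"
      then have v: "v extreme_point_of (Sp \<inter> Sm)"
        by simp
      then obtain k where k: "v = row k V"
        using vert[OF F v] rows by (auto simp: rows_def)
      have "b \<bullet> v = 0"
        using orth[of v] v b by (auto simp: extreme_point_of_def)
      then have "0 \<le> row k V \<bullet> x"
        using x k by (metis mem_envelope w max.idem neg_equal_0_iff_equal)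
      then show "v \<in> {y. 0 \<le> x \<bullet> y}"
        using k by (simp add: inner_commute)
    qed
    have "compact (Sp \<inter> Sm)" "convex (Sp \<inter> Sm)"
      using poly by (auto intro: compact_Int polytope_imp_compact convex_Int polytope_imp_convex)
    then have "Sp \<inter> Sm \<subseteq> {y. 0 \<le> x \<bullet> y}"
      using Krein_Milman_Minkowski[of "Sp \<inter> Sm"] hull_minimal[OF ext, of convex]
      by (simp add: convex_halfspace_ge)
    then have "0 \<le> x \<bullet> ((1 - t) *\<^sub>R row i V + t *\<^sub>R row j V)"
      using t by blast
    then have "0 \<le> (1 - t) * (row i V \<bullet> x) + t * (row j V \<bullet> x)"
      by (simp add: inner_add_right inner_commute)
    \<comment> \<open>Multiplying by this positive factor lets \<open>teq\<close> eliminate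
      \<open>t\<close>.\<close>
    then have "0 \<le> (b \<bullet> row i V - b \<bullet> row j V) * ((1 - t) * (row i V \<bullet> x) + t * (row j V \<bullet> x))"
      using i j by (intro mult_nonneg_nonneg) auto
    also have "\<dots> = (b \<bullet> row i V - b \<bullet> row j V) * (row i V \<bullet> x) +
        t * (b \<bullet> row i V - b \<bullet> row j V) * (row j V \<bullet> x - row i V \<bullet> x)"
      by (simp add: algebra_simps)
    also have "\<dots> = (row j V \<bullet> x) * (b \<bullet> row i V) - (row i V \<bullet> x) * (b \<bullet> row j V)"
      unfolding teq by (simp add: algebra_simps)
    finally show ?thesis .
  qed
  \<comment> \<open>The endpoint \<open>p\<close> is \<open>- b\<close>.\<close>
  show ?thesis
    using envelope_max_0[OF w cross] by blast
qed

section \<open>Linear span of \<open>P\<close>\<close>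

text \<open>The all-ones condition puts \<open>P\<close> in an affine hyperplane missing the origin,
  so \<open>P\<close> together with 0 has full dimension and lies in no linear hyperplane.\<close>

lemma exists_not_orthogonal:
  fixes V :: "real ^ 'm ^ 'n"
  assumes V: "vertex_matrix V P"
    and dim: "aff_dim P = int CARD('m) - 1"
    and ones: "(\<chi> i. 1) \<in> span (columns V)"
    and "a \<noteq> 0"
  shows "\<exists>v\<in>P. a \<bullet> v \<noteq> 0"
proof (rule ccontr)
  assume "\<not> ?thesis"
  then have sub: "P \<subseteq> {x. a \<bullet> x = 0}"
    by blast
  \<comment> \<open>Columns are images of basis vectors, so the all-ones vector has a preimage
    \<open>c\<close>, which takes the value 1 at every vertex.\<close>
  have "columns V \<subseteq> range ((*v) V)"
    by (auto simp: columns_def matrix_vector_mult_basis[symmetric])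
  moreover have "subspace (range ((*v) V))"
    by (simp add: linear_subspace_image)
  ultimately have "span (columns V) \<subseteq> range ((*v) V)"
    by (rule span_minimal)
  then obtain c where "V *v c = (\<chi> i. 1)"
    using ones by fastforce
  then have c: "c \<bullet> row i V = 1" for i
    by (metis inner_commute matrix_vector_mul_component row_def vec_lambda_beta vec_lambda_eta)
  have rows: "rows V = {v. v extreme_point_of P}" and "polytope P"
    using V by (auto simp: vertex_matrix_def)
  then have P: "P = convex hull {v. v extreme_point_of P}"
    by (intro Krein_Milman_Minkowski polytope_imp_compact polytope_imp_convex)
  have "convex hull (rows V) \<subseteq> {x. c \<bullet> x = 1}"
    by (intro hull_minimal convex_hyperplane) (auto simp: rows_def c)
  then have "P \<subseteq> {x. c \<bullet> x = 1}"
    using P rows by simp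
  then have "affine hull P \<subseteq> {x. c \<bullet> x = 1}"
    by (intro hull_minimal affine_hyperplane)
  then have "0 \<notin> affine hull P"
    by auto
  \<comment> \<open>Adjoining a point outside the affine hull raises the dimension by one, above
    that of a hyperplane.\<close>
  then have "aff_dim (insert 0 P) = int CARD('m)"
    using dim by (simp add: aff_dim_insert)
  moreover have "insert 0 P \<subseteq> {x. a \<bullet> x = 0}"
    using sub by simp
  then have "aff_dim (insert 0 P) \<le> aff_dim {x. a \<bullet> x = 0}"
    by (rule aff_dim_subset)
  ultimately show False
    using aff_dim_hyperplane[OF \<open>a \<noteq> 0\<close>, of 0] by simp
qed

theorem theorem4p11:
  fixes V :: "real ^ 'm ^ 'n"
    and P :: "(real ^ 'm) set"
    and \<S> :: "(real ^ 'm) set set set"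
    and Sp Sm :: "(real ^ 'm) set set \<Rightarrow> (real ^ 'm) set"
    and a :: "(real ^ 'm) set set \<Rightarrow> real ^ 'm"
  assumes "vertex_matrix V P"
    and "aff_dim P = int CARD('m) - 1"
    and "(\<chi> i. 1) \<in> span (columns V)"
    and "\<And>S. S \<in> \<S> \<Longrightarrow> is_split S P"
    and "\<And>S. S \<in> \<S> \<Longrightarrow> split_data S (Sp S) (Sm S) (a S)"
    and "weakly_compatible V \<S> Sp a"
  shows "zonotopal_complex (tight_span V (\<Sum>S\<in>\<S>. split_weight V (Sp S) (a S)))"
proof -
  let ?w = "\<lambda>S. split_weight V (Sp S) (a S)"
  have "\<exists>p. envelope V (?w S) = closed_segment 0 p + envelope V 0" if "S \<in> \<S>" for S
  proof (rule envelope_split_weight)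
    show "\<exists>v\<in>P. a S \<bullet> v \<noteq> 0"
      using exists_not_orthogonal assms(1,2,3) assms(5)[OF that] unfolding split_data_def by blast
  qed (use assms that in auto)
  then obtain p where p: "\<And>S. S \<in> \<S> \<Longrightarrow> envelope V (?w S) = closed_segment 0 (p S) + envelope V 0"
    by metis
  define Z where "Z = (\<Sum>S\<in>\<S>. closed_segment 0 (p S))"
  have Z: "zonotope Z"
    unfolding Z_def by (intro zonotope_sum zonotope_closed_segment)
  have env: "envelope V (\<Sum>S\<in>\<S>. ?w S) = Z + envelope V 0"
  \<comment> \<open>Weak compatibility gives coherence only for a non-empty family, and merging the
    cones requires a finite one.\<close>
  proof (cases "finite \<S> \<and> \<S> \<noteq> {}")
    case True
    then have "envelope V (\<Sum>S\<in>\<S>. ?w S) = (\<Sum>S\<in>\<S>. envelope V (?w S))"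
      using assms(6) by (simp add: weakly_compatible_def coherent_decomposition_def)
    also have "\<dots> = (\<Sum>S\<in>\<S>. closed_segment 0 (p S) + envelope V 0)"
      by (intro sum.cong refl p)
    finally show ?thesis
      using True by (simp add: sum_add_envelope_0 Z_def)
  next
    case False
    \<comment> \<open>Sums over an infinite set are \<open>0\<close> as well, so the claim is \<open>C = {0} + C\<close> in both cases.\<close>
    then show ?thesis
      by (auto simp: Z_def)
  qed
  have "zonotope F" if "F \<in> tight_span V (\<Sum>S\<in>\<S>. ?w S)" "F \<noteq> {}" for F
    using that zonotope_face[OF Z] bounded_face_of_add_envelope_0[of F Z V]
    by (simp add: tight_span_def env)
  then show ?thesis
    by (simp add: zonotopal_complex_def polytopal_complex_tight_span)
qed

end
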